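(* Let $G=(V,E)$, $w:E\to\mathbb{Q}_{\ge 0}$, be a concurrent (general graph matching) game that is degenerate, i.e. has more than one maximum weight integral matching. Then: (1) viable players are treated by core imputations in the same way as subpar players, namely they are never paid: if $q\in V$ is viable or subpar, then $y_q=0$ for every imputation $y$ in the core; (2) viable teams are treated by core imputations in the same way as essential teams, namely they are always fairly paid: if $e=(i,j)\in E$ is viable or essential, then $y_i+y_j=w_e$ for every imputation $y$ in the core.
   Context: General graph matching game: $G=(V,E)$ is a finite undirected (not necessarily bipartite) graph with edge weights $w$. The players are the vertices and the teams are the edges. The worth $p(S)$ of a coalition $S\subseteq V$ is the weight of a maximum weight (integral) matching in the subgraph induced on $S$. An imputation is a function $y:V\to\mathbb{R}_{\ge 0}$ with $\sum_{i\in V}y_i=p(V)$. It is in the core if $\sum_{i\in S}y_i\ge p(S)$ for all $S\subseteq V$. A fractional matching is a vector $x\in\mathbb{R}_{\ge 0}^E$ with $\sum_{e\ni i}x_e\le 1$ for all $i\in V$; its weight is $\sum_e w_ex_e$. The game is concurrent if the maximum weight of a fractional matching equals the maximum weight of an integral matching (equivalently, the core is non-empty). A player (respectively, team) is essential if it is matched in (respectively, belongs to) every maximum weight integral matching; viable if it is matched in (belongs to) some maximum weight integral matching but not in (to) some other one; subpar if it is matched in (belongs to) no maximum weight integral matching. *)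

theory Defs
  imports Complex_Main
begin

text \<open>
  An undirected simple graph has a vertex set \<open>V :: 'a set\<close> and an edge set \<open>E :: 'a set set\<close> of
  two-element subsets of \<open>V\<close>; edge weights, fractional matchings and payoffs are total functions
  of which only the values on \<open>E\<close>, respectively \<open>V\<close>, matter.
\<close>

definition finite_graph :: "'a set \<Rightarrow> 'a set set \<Rightarrow> bool" where
  "finite_graph V E \<longleftrightarrow> finite V \<and> (\<forall>e\<in>E. e \<subseteq> V \<and> card e = 2)"

definition matching :: "'a set set \<Rightarrow> 'a set set \<Rightarrow> bool" where
  "matching E M \<longleftrightarrow> M \<subseteq> E \<and> pairwise disjnt M"

definition matching_weight :: "('a set \<Rightarrow> real) \<Rightarrow> 'a set set \<Rightarrow> real" where
  "matching_weight w M = (\<Sum>e\<in>M. w e)"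

definition max_weight_matching :: "'a set set \<Rightarrow> ('a set \<Rightarrow> real) \<Rightarrow> 'a set set \<Rightarrow> bool" where
  "max_weight_matching E w M \<longleftrightarrow>
     matching E M \<and> (\<forall>N. matching E N \<longrightarrow> matching_weight w N \<le> matching_weight w M)"

definition induced_edges :: "'a set set \<Rightarrow> 'a set \<Rightarrow> 'a set set" where
  "induced_edges E S = {e \<in> E. e \<subseteq> S}"

definition worth :: "'a set set \<Rightarrow> ('a set \<Rightarrow> real) \<Rightarrow> 'a set \<Rightarrow> real" where
  "worth E w S = Max {matching_weight w M | M. matching (induced_edges E S) M}"

definition imputation :: "'a set \<Rightarrow> 'a set set \<Rightarrow> ('a set \<Rightarrow> real) \<Rightarrow> ('a \<Rightarrow> real) \<Rightarrow> bool" where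
  "imputation V E w y \<longleftrightarrow> (\<forall>i\<in>V. 0 \<le> y i) \<and> (\<Sum>i\<in>V. y i) = worth E w V"

definition core_imputation :: "'a set \<Rightarrow> 'a set set \<Rightarrow> ('a set \<Rightarrow> real) \<Rightarrow> ('a \<Rightarrow> real) \<Rightarrow> bool" where
  "core_imputation V E w y \<longleftrightarrow>
     imputation V E w y \<and> (\<forall>S. S \<subseteq> V \<longrightarrow> worth E w S \<le> (\<Sum>i\<in>S. y i))"

definition fractional_matching :: "'a set \<Rightarrow> 'a set set \<Rightarrow> ('a set \<Rightarrow> real) \<Rightarrow> bool" where
  "fractional_matching V E x \<longleftrightarrow>
     (\<forall>e\<in>E. 0 \<le> x e) \<and> (\<forall>i\<in>V. (\<Sum>e | e \<in> E \<and> i \<in> e. x e) \<le> 1)"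

definition fractional_weight :: "'a set set \<Rightarrow> ('a set \<Rightarrow> real) \<Rightarrow> ('a set \<Rightarrow> real) \<Rightarrow> real" where
  "fractional_weight E w x = (\<Sum>e\<in>E. w e * x e)"

definition max_weight_fractional_matching ::
    "'a set \<Rightarrow> 'a set set \<Rightarrow> ('a set \<Rightarrow> real) \<Rightarrow> ('a set \<Rightarrow> real) \<Rightarrow> bool" where
  "max_weight_fractional_matching V E w x \<longleftrightarrow>
     fractional_matching V E x \<and>
     (\<forall>z. fractional_matching V E z \<longrightarrow> fractional_weight E w z \<le> fractional_weight E w x)"

definition concurrent :: "'a set \<Rightarrow> 'a set set \<Rightarrow> ('a set \<Rightarrow> real) \<Rightarrow> bool" where
  "concurrent V E w \<longleftrightarrow>
     (\<exists>x M. max_weight_fractional_matching V E w x \<and> max_weight_matching E w M \<and>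
            fractional_weight E w x = matching_weight w M)"

definition degenerate :: "'a set set \<Rightarrow> ('a set \<Rightarrow> real) \<Rightarrow> bool" where
  "degenerate E w \<longleftrightarrow>
     (\<exists>M N. max_weight_matching E w M \<and> max_weight_matching E w N \<and> M \<noteq> N)"

definition viable_player :: "'a set set \<Rightarrow> ('a set \<Rightarrow> real) \<Rightarrow> 'a \<Rightarrow> bool" where
  "viable_player E w i \<longleftrightarrow>
     (\<exists>M. max_weight_matching E w M \<and> i \<in> \<Union>M) \<and> (\<exists>M. max_weight_matching E w M \<and> i \<notin> \<Union>M)"

definition subpar_player :: "'a set set \<Rightarrow> ('a set \<Rightarrow> real) \<Rightarrow> 'a \<Rightarrow> bool" where
  "subpar_player E w i \<longleftrightarrow> (\<forall>M. max_weight_matching E w M \<longrightarrow> i \<notin> \<Union>M)"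

definition essential_team :: "'a set set \<Rightarrow> ('a set \<Rightarrow> real) \<Rightarrow> 'a set \<Rightarrow> bool" where
  "essential_team E w e \<longleftrightarrow> (\<forall>M. max_weight_matching E w M \<longrightarrow> e \<in> M)"

definition viable_team :: "'a set set \<Rightarrow> ('a set \<Rightarrow> real) \<Rightarrow> 'a set \<Rightarrow> bool" where
  "viable_team E w e \<longleftrightarrow>
     (\<exists>M. max_weight_matching E w M \<and> e \<in> M) \<and> (\<exists>M. max_weight_matching E w M \<and> e \<notin> M)"

end

(* Complementary slackness: for a core imputation y and a maximum weight matching M,
   w(M) = y(V) >= sum of y(e) over e in M >= w(M), so M leaves no payoff on unmatched
   vertices and every edge of M is tight. *)
theory Submission
  imports Defs
begin

lemma finite_graph_finite_edges:
  assumes "finite_graph V E"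
  shows "finite E"
  using assms finite_subset[of E "Pow V"] by (auto simp: finite_graph_def)

text \<open>Makes the \<open>Max\<close> in \<open>worth\<close> usable: \<open>Max_ge\<close> and
  \<open>Max_eqI\<close> need a finite set.\<close>

lemma finite_matching_weights:
  assumes "finite E"
  shows "finite {matching_weight w M | M. matching E M}"
proof -
  have "{matching_weight w M | M. matching E M} \<subseteq> matching_weight w ` Pow E"
    by (auto simp: matching_def)
  then show ?thesis
    using assms finite_subset by blast
qed

text \<open>The edge, being a set of vertices, doubles as a coalition, and \<open>{e}\<close> is a
  matching of the subgraph induced on it.\<close>

lemma worth_ge_edge_weight:
  assumes "finite E" "e \<in> E"
  shows "w e \<le> worth E w e"
proof -
  have "matching (induced_edges E e) {e}"
    using assms(2) by (auto simp: matching_def induced_edges_def)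
  moreover have "matching_weight w {e} = w e"
    by (simp add: matching_weight_def)
  ultimately have "w e \<in> {matching_weight w M | M. matching (induced_edges E e) M}"
    by (metis (mono_tags, lifting) mem_Collect_eq)
  moreover have "finite (induced_edges E e)"
    using assms(1) by (simp add: induced_edges_def)
  ultimately show ?thesis
    unfolding worth_def using finite_matching_weights Max_ge by blast
qed

lemma worth_eq_matching_weight:
  assumes "finite_graph V E" "max_weight_matching E w M"
  shows "worth E w V = matching_weight w M"
proof -
  have "induced_edges E V = E"
    using assms(1) by (auto simp: induced_edges_def finite_graph_def)
  then show ?thesis
    unfolding worth_def
    using finite_matching_weights[OF finite_graph_finite_edges[OF assms(1)]] assms(2)
    by (intro Max_eqI) (auto simp: max_weight_matching_def)
qed

text \<open>Dual feasibility: the core condition for the coalition formed by the endpoints of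
  \<open>e\<close> is the constraint of \<open>e\<close> in the fractional vertex cover LP.\<close>

lemma core_edge_covered:
  assumes "finite_graph V E" "core_imputation V E w y" "e \<in> E"
  shows "w e \<le> sum y e"
proof -
  have "e \<subseteq> V"
    using assms(1,3) by (auto simp: finite_graph_def)
  then have "worth E w e \<le> sum y e"
    using assms(2) by (auto simp: core_imputation_def)
  then show ?thesis
    using worth_ge_edge_weight[OF finite_graph_finite_edges[OF assms(1)] assms(3)]
    by (rule order_trans[rotated])
qed

text \<open>\<open>M\<close> is arbitrary because the total payoff is the same for all optima; each
  use can pick an optimum containing a given edge or missing a given vertex.\<close>

lemma core_complementary_slackness:
  assumes G: "finite_graph V E" and M: "max_weight_matching E w M"
    and y: "core_imputation V E w y"
  shows core_matched_edge_tight: "e \<in> M \<Longrightarrow> sum y e = w e"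
    and core_unmatched_vertex_unpaid: "q \<in> V \<Longrightarrow> q \<notin> \<Union>M \<Longrightarrow> y q = 0"
proof -
  have finV: "finite V" and edges: "\<And>e. e \<in> E \<Longrightarrow> e \<subseteq> V"
    using G by (auto simp: finite_graph_def)
  have ME: "M \<subseteq> E" and disj: "pairwise disjnt M"
    using M by (auto simp: max_weight_matching_def matching_def)
  have finM: "finite M"
    using ME finite_graph_finite_edges[OF G] finite_subset by blast
  have MV: "\<Union>M \<subseteq> V"
    using ME edges by blast
  have nonneg: "\<And>i. i \<in> V \<Longrightarrow> 0 \<le> y i"
    using y by (auto simp: core_imputation_def imputation_def)
  have "sum y V = matching_weight w M"
    using y worth_eq_matching_weight[OF G M] by (simp add: core_imputation_def imputation_def)
  moreover have "sum y V = sum y (V - \<Union>M) + sum y (\<Union>M)"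
    using finV MV by (simp add: sum.subset_diff)
  \<comment> \<open>Every matched vertex lies in exactly one edge of \<open>M\<close>, so its payoff
    is counted once.\<close>
  moreover have "sum y (\<Union>M) = (\<Sum>e\<in>M. sum y e)"
  proof -
    have "\<forall>e\<in>M. finite e"
      using ME edges finV finite_subset by blast
    moreover have "\<forall>e\<in>M. \<forall>f\<in>M. e \<noteq> f \<longrightarrow> e \<inter> f = {}"
      using disj by (auto simp: pairwise_def disjnt_def)
    ultimately show ?thesis
      by (simp add: sum.Union_disjoint)
  qed
  \<comment> \<open>The unmatched payoff and the total slack of the matched edges cancel. Both are
    sums of nonnegative terms, so every single term is zero.\<close>
  ultimately have balance: "sum y (V - \<Union>M) + (\<Sum>e\<in>M. sum y e - w e) = 0"
    by (simp add: matching_weight_def sum_subtractf)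
  have slack: "\<And>e. e \<in> M \<Longrightarrow> 0 \<le> sum y e - w e"
    using core_edge_covered[OF G y] ME by fastforce
  have "0 \<le> sum y (V - \<Union>M)" "0 \<le> (\<Sum>e\<in>M. sum y e - w e)"
    using nonneg slack by (auto intro!: sum_nonneg)
  with balance have "sum y (V - \<Union>M) = 0" "(\<Sum>e\<in>M. sum y e - w e) = 0"
    by linarith+
  then show "e \<in> M \<Longrightarrow> sum y e = w e" "q \<in> V \<Longrightarrow> q \<notin> \<Union>M \<Longrightarrow> y q = 0"
    using sum_nonneg_eq_0_iff[OF finM slack] sum_nonneg_eq_0_iff[of "V - \<Union>M" y] finV nonneg
    by auto
qed

theorem corollary5:
  fixes V :: "'a set" and E :: "'a set set" and w :: "'a set \<Rightarrow> real"
  assumes "finite_graph V E"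
    and "\<forall>e\<in>E. w e \<in> \<rat> \<and> 0 \<le> w e"
    and "concurrent V E w"
    and "degenerate E w"
  shows "(\<forall>q\<in>V. viable_player E w q \<or> subpar_player E w q \<longrightarrow>
            (\<forall>y. core_imputation V E w y \<longrightarrow> y q = 0)) \<and>
         (\<forall>i j. {i, j} \<in> E \<longrightarrow> viable_team E w {i, j} \<or> essential_team E w {i, j} \<longrightarrow>
            (\<forall>y. core_imputation V E w y \<longrightarrow> y i + y j = w {i, j}))"
proof (intro conjI ballI allI impI)
  \<comment> \<open>Subpar and essential quantify over all optima; an actual optimum keeps them from
    holding vacuously.\<close>
  obtain M where M: "max_weight_matching E w M"
    using assms(4) by (auto simp: degenerate_def)
  {
    fix q y
    assume "q \<in> V" "viable_player E w q \<or> subpar_player E w q" and y: "core_imputation V E w y"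
    \<comment> \<open>A viable \<open>q\<close> brings its own optimum missing it; for a subpar
      \<open>q\<close>, \<open>M\<close> serves.\<close>
    moreover from this obtain N where "max_weight_matching E w N" "q \<notin> \<Union>N"
      using M by (auto simp: viable_player_def subpar_player_def)
    ultimately show "y q = 0"
      using core_unmatched_vertex_unpaid[OF assms(1)] by blast
  next
    fix i j y
    assume ij: "{i, j} \<in> E" "viable_team E w {i, j} \<or> essential_team E w {i, j}"
      and y: "core_imputation V E w y"
    \<comment> \<open>Dually, \<open>N\<close> is the optimum witnessing viability, or
      \<open>M\<close> for an essential team.\<close>
    then obtain N where "max_weight_matching E w N" "{i, j} \<in> N"
      using M by (auto simp: viable_team_def essential_team_def)
    then have "sum y {i, j} = w {i, j}"
      using core_matched_edge_tight[OF assms(1)] y by blast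
    \<comment> \<open>Excludes \<open>i = j\<close>, where \<open>sum y {i, j}\<close> would
      collapse to \<open>y i\<close>.\<close>
    moreover have "card {i, j} = 2"
      using assms(1) ij(1) by (auto simp: finite_graph_def)
    then have "i \<noteq> j"
      by auto
    ultimately show "y i + y j = w {i, j}"
      by simp
  }
qed

end
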